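(* Let $Z$ be a smooth vector field on $\mathbb{R}^{2n}$, let $\Gamma:\mathbb{R}^{2n}\to\mathbb{R}$ be smooth, and let $\xi\in\mathbb{R}$. Let $\tau:\mathbb{R}^{2n}\to\mathbb{R}^+\cup\{\infty\}$ be the inter-execution times for the system $\dot{\mathrm{z}}=Z(\mathrm{z})$ implicitly defined by $\Gamma(\mathrm{z}(\tau(z),z))=0$ for a point $z\in\mathbb{R}^{2n}$. Let $\tilde\tau$ be the inter-execution times, with values in $\mathbb{R}^+\cup\{\infty\}$, for the system on $\{(z,w)\in\mathbb{R}^{2n}\times\mathbb{R}: w>0\}$ $$\begin{bmatrix}\dot{\mathrm{z}}\\ \dot{\mathrm{w}}\end{bmatrix}=S(\mathrm{z},\mathrm{w})=\begin{bmatrix}\mathrm{w}^{\xi+1}Z(\mathrm{w}^{-1}\mathrm{z})\\ 0\end{bmatrix}$$ implicitly defined by $\Gamma\big(w^{-1}\mathrm{z}(\tilde\tau(z,w),z,w)\big)=0$ for a point $(z,w)$. Then $\tau$ and $\tilde\tau$ are related by $$\tau(z)=\lambda^{\xi}\,\tilde\tau(\lambda z,\lambda)\qquad\text{for all } \lambda>0 .$$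
   Context: $\mathrm{z}(t,z)$ denotes the solution of $\dot{\mathrm{z}}=Z(\mathrm{z})$ with initial condition $z$; $\mathrm{z}(t,z,w)$ denotes the $z$-component of the solution of the system defined by $S$ with initial condition $(z,w)$ (its $w$-component is constant, equal to $w$). The inter-execution time implicitly defined by a triggering condition is the minimum time $t>0$ at which the condition holds along the solution starting at the given point: $\tau(z)=\min\{t>0:\Gamma(\mathrm{z}(t,z))=0\}$ and $\tilde\tau(z,w)=\min\{t>0:\Gamma(w^{-1}\mathrm{z}(t,z,w))=0\}$, with the value $\infty$ if there is no such $t$. It is part of the setting that these functions are well defined. *)

theory Defs
  imports "HOL-Analysis.Analysis"
begin

text \<open>\<open>C\<^sup>k\<close> maps: the derivative at \<open>x\<close> is a linear map, so its dependence on \<open>x\<close> is tested on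
  every fixed direction \<open>v\<close>; in finite dimension this is the usual notion.\<close>

primrec C_times :: "nat \<Rightarrow> ('a::euclidean_space \<Rightarrow> 'b::euclidean_space) \<Rightarrow> bool" where
  "C_times 0 f \<longleftrightarrow> continuous_on UNIV f"
| "C_times (Suc k) f \<longleftrightarrow>
     (\<forall>x. f differentiable (at x)) \<and> (\<forall>v. C_times k (\<lambda>x. frechet_derivative f (at x) v))"

definition smooth :: "('a::euclidean_space \<Rightarrow> 'b::euclidean_space) \<Rightarrow> bool" where
  "smooth f \<longleftrightarrow> (\<forall>k. C_times k f)"

definition solves_ivp ::
  "('a::real_normed_vector \<Rightarrow> 'a) \<Rightarrow> 'a set \<Rightarrow> 'a \<Rightarrow> real set \<Rightarrow> (real \<Rightarrow> 'a) \<Rightarrow> bool" where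
  "solves_ivp f X x0 J x \<longleftrightarrow>
     open J \<and> is_interval J \<and> 0 \<in> J \<and> x 0 = x0 \<and>
     (\<forall>t\<in>J. x t \<in> X \<and> (x has_vector_derivative f (x t)) (at t))"

text \<open>The maximal solution of an initial value problem in the state space \<open>X\<close>, together with its
  interval of existence. The vector field need not be complete; \<open>solution f X x0 t\<close> is meaningful
  only for \<open>t\<close> in \<open>existence_interval f X x0\<close>.\<close>

definition existence_interval ::
  "('a::real_normed_vector \<Rightarrow> 'a) \<Rightarrow> 'a set \<Rightarrow> 'a \<Rightarrow> real set" where
  "existence_interval f X x0 = \<Union>{J. \<exists>x. solves_ivp f X x0 J x}"

definition solution ::
  "('a::real_normed_vector \<Rightarrow> 'a) \<Rightarrow> 'a set \<Rightarrow> 'a \<Rightarrow> real \<Rightarrow> 'a" where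
  "solution f X x0 t = (THE y. \<exists>J x. solves_ivp f X x0 J x \<and> t \<in> J \<and> y = x t)"

definition trigger_times ::
  "('a::real_normed_vector \<Rightarrow> 'a) \<Rightarrow> 'a set \<Rightarrow> ('a \<Rightarrow> real) \<Rightarrow> 'a \<Rightarrow> real set" where
  "trigger_times f X g x0 =
     {t. 0 < t \<and> t \<in> existence_interval f X x0 \<and> g (solution f X x0 t) = 0}"

text \<open>\<open>T = min A\<close>, with \<open>T = \<infinity>\<close> for empty \<open>A\<close>. No \<open>T\<close> qualifies if \<open>A\<close> is
  nonempty without a minimum: then the inter-execution time is not well defined.\<close>

definition is_min_or_infinity :: "real set \<Rightarrow> ereal \<Rightarrow> bool" where
  "is_min_or_infinity A T \<longleftrightarrow>
     (A = {} \<and> T = \<infinity>) \<or> (\<exists>t\<in>A. (\<forall>s\<in>A. t \<le> s) \<and> T = ereal t)"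

definition is_inter_execution_time ::
  "('a::real_normed_vector \<Rightarrow> 'a) \<Rightarrow> 'a set \<Rightarrow> ('a \<Rightarrow> real) \<Rightarrow> 'a \<Rightarrow> ereal \<Rightarrow> bool" where
  "is_inter_execution_time f X g x0 T \<longleftrightarrow> is_min_or_infinity (trigger_times f X g x0) T"

definition lifted_field ::
  "real \<Rightarrow> ('a::real_normed_vector \<Rightarrow> 'a) \<Rightarrow> 'a \<times> real \<Rightarrow> 'a \<times> real" where
  "lifted_field \<xi> Z = (\<lambda>(z, w). (w powr (\<xi> + 1) *\<^sub>R Z (inverse w *\<^sub>R z), 0))"

definition lifted_space :: "('a \<times> real) set" where
  "lifted_space = {(z, w). w > 0}"

end

theory Submission
  imports Defs
begin

text \<open>
  Writing \<open>c = \<lambda>\<^sup>\<xi>\<close>, the change of variables \<open>x \<mapsto> (\<lambda> x(c t), \<lambda>)\<close> turns solutions of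
  \<open>z' = Z(z)\<close> starting at \<open>z\<close> into solutions of the lifted system starting at \<open>(\<lambda> z, \<lambda>)\<close>: the
  chain rule produces the factor \<open>\<lambda> c = \<lambda>\<^sup>\<xi>\<^sup>+\<^sup>1\<close> of the lifted field. Since the \<open>w\<close>-component of
  every solution of the lifted system is constant, all its solutions starting at \<open>(\<lambda> z, \<lambda>)\<close>
  arise in this way (\<open>solves_ivp_lift\<close>, \<open>solves_ivp_unlift\<close>). The triggering function
  undoes the spatial scaling, so \<open>t\<close> is a trigger time of the lifted system exactly when \<open>c t\<close> is
  one of the original system, and the least elements of the two sets differ by the factor \<open>c\<close>.

  The flow is specified by a definite description, so that corresponding solutions
  have corresponding values only once solutions are known to be unique. Uniqueness is needed
  for \<open>Z\<close> alone, because the correspondence carries it over to the lifted system. It is the classical argument: a \<open>C\<^sup>1\<close> field is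
  locally Lipschitz, a Gronwall estimate makes the set where two solutions agree open, and
  connectedness finishes.
\<close>

section \<open>Uniqueness of solutions\<close>

text \<open>Continuity of the derivative in the finitely many basis directions bounds its operator
  norm on compact sets, and the mean value inequality does the rest.\<close>

lemma C1_locally_Lipschitz:
  fixes f :: "'a::euclidean_space \<Rightarrow> 'b::euclidean_space"
  assumes "C_times 1 f"
  obtains L where "\<And>u v. u \<in> cball p 1 \<Longrightarrow> v \<in> cball p 1 \<Longrightarrow> norm (f u - f v) \<le> L * norm (u - v)"
proof -
  let ?D = "\<lambda>x. frechet_derivative f (at x)"
  have diff: "f differentiable (at x)" for x
    using assms by simp
  have cont: "continuous_on UNIV (\<lambda>x. ?D x v)" for v
    using assms by simp
  have "continuous_on (cball p 1) (\<lambda>x. \<Sum>i\<in>Basis. norm (?D x i))"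
    by (intro continuous_on_sum continuous_on_norm continuous_on_subset[OF cont]) simp
  then have "bounded ((\<lambda>x. \<Sum>i\<in>Basis. norm (?D x i)) ` cball p 1)"
    by (intro compact_imp_bounded compact_continuous_image compact_cball)
  then obtain L where L: "\<And>x. x \<in> cball p 1 \<Longrightarrow> norm (\<Sum>i\<in>Basis. norm (?D x i)) \<le> L"
    unfolding bounded_iff by blast
  have bound: "onorm (?D x) \<le> L" if "x \<in> cball p 1" for x
  proof -
    have "bounded_linear (?D x)"
      using diff[of x] by (simp add: frechet_derivative_works has_derivative_bounded_linear)
    then have "onorm (?D x) \<le> (\<Sum>i\<in>Basis. norm (?D x i))"
      by (rule onorm_componentwise)
    also have "\<dots> \<le> L"
      using L[OF that] by simp
    finally show ?thesis .
  qed
  have der: "(f has_derivative ?D x) (at x within cball p 1)" for x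
    using diff[of x] by (simp add: frechet_derivative_works has_derivative_at_withinI)
  have "norm (f u - f v) \<le> L * norm (u - v)" if "u \<in> cball p 1" "v \<in> cball p 1" for u v
    by (rule differentiable_bound[OF convex_cball der bound]) (use that in auto)
  then show ?thesis
    by (rule that)
qed

text \<open>A Gronwall estimate without integrals: the hypothesis makes \<open>d(t) exp (-K t)\<close>
  nonincreasing and \<open>d(t) exp (K t)\<close> nondecreasing, so that a zero of \<open>d\<close> propagates forwards by
  the first and backwards by the second.\<close>

lemma differential_inequality_imp_zero:
  fixes d d' :: "real \<Rightarrow> real"
  assumes deriv: "\<And>s. s \<in> I \<Longrightarrow> (d has_real_derivative d' s) (at s)"
    and bound: "\<And>s. s \<in> I \<Longrightarrow> \<bar>d' s\<bar> \<le> K * d s"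
    and nonneg: "\<And>s. s \<in> I \<Longrightarrow> 0 \<le> d s"
    and "is_interval I" "a \<in> I" "d a = 0" "t \<in> I"
  shows "d t = 0"
proof (cases "a \<le> t")
  case True
  have I: "s \<in> I" if "a \<le> s" "s \<le> t" for s
    using \<open>is_interval I\<close> \<open>a \<in> I\<close> \<open>t \<in> I\<close> that unfolding is_interval_1 by blast
  have "d t * exp (- K * t) \<le> d a * exp (- K * a)"
  proof (rule DERIV_nonpos_imp_nonincreasing[OF True])
    fix s assume s: "a \<le> s" "s \<le> t"
    have "((\<lambda>s. d s * exp (- K * s)) has_real_derivative (d' s - K * d s) * exp (- K * s)) (at s)"
      by (auto intro!: derivative_eq_intros deriv[OF I[OF s]] simp: algebra_simps)
    moreover have "(d' s - K * d s) * exp (- K * s) \<le> 0"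
      using bound[OF I[OF s]] by (intro mult_nonpos_nonneg) auto
    ultimately show "\<exists>y. ((\<lambda>s. d s * exp (- K * s)) has_real_derivative y) (at s) \<and> y \<le> 0"
      by blast
  qed
  then show ?thesis
    using nonneg[OF \<open>t \<in> I\<close>] \<open>d a = 0\<close> by (simp add: mult_le_0_iff)
next
  case False
  have I: "s \<in> I" if "t \<le> s" "s \<le> a" for s
    using \<open>is_interval I\<close> \<open>a \<in> I\<close> \<open>t \<in> I\<close> that unfolding is_interval_1 by blast
  have "d t * exp (K * t) \<le> d a * exp (K * a)"
  proof (rule DERIV_nonneg_imp_nondecreasing[where f = "\<lambda>s. d s * exp (K * s)"])
    show "t \<le> a"
      using False by simp
  next
    fix s assume s: "t \<le> s" "s \<le> a"
    have "((\<lambda>s. d s * exp (K * s)) has_real_derivative (d' s + K * d s) * exp (K * s)) (at s)"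
      by (auto intro!: derivative_eq_intros deriv[OF I[OF s]] simp: algebra_simps)
    moreover have "0 \<le> (d' s + K * d s) * exp (K * s)"
      using bound[OF I[OF s]] by (intro mult_nonneg_nonneg) auto
    ultimately show "\<exists>y. ((\<lambda>s. d s * exp (K * s)) has_real_derivative y) (at s) \<and> 0 \<le> y"
      by blast
  qed
  then show ?thesis
    using nonneg[OF \<open>t \<in> I\<close>] \<open>d a = 0\<close> by (simp add: mult_le_0_iff)
qed

text \<open>The squared distance of two solutions satisfies the differential inequality above as long
  as both stay where the field is Lipschitz.\<close>

lemma C1_solutions_agree_locally:
  fixes f :: "'a::euclidean_space \<Rightarrow> 'a"
  assumes C1: "C_times 1 f" and "open I" "a \<in> I" and eq: "x a = y a"
    and x: "\<And>t. t \<in> I \<Longrightarrow> (x has_vector_derivative f (x t)) (at t)"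
    and y: "\<And>t. t \<in> I \<Longrightarrow> (y has_vector_derivative f (y t)) (at t)"
  shows "\<exists>e>0. \<forall>t. dist t a < e \<longrightarrow> x t = y t"
proof -
  obtain L where L: "\<And>u v. u \<in> cball (x a) 1 \<Longrightarrow> v \<in> cball (x a) 1 \<Longrightarrow>
      norm (f u - f v) \<le> L * norm (u - v)"
    using C1_locally_Lipschitz[OF C1] by blast
  have "isCont x a" "isCont y a"
    using x[OF \<open>a \<in> I\<close>] y[OF \<open>a \<in> I\<close>] by (auto intro: has_vector_derivative_continuous)
  then obtain e1 e2 where "0 < e1" "0 < e2"
    and e1: "\<And>t. dist t a < e1 \<Longrightarrow> dist (x t) (x a) < 1"
    and e2: "\<And>t. dist t a < e2 \<Longrightarrow> dist (y t) (y a) < 1"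
    using zero_less_one[where 'a = real] unfolding continuous_at_eps_delta by metis
  obtain e3 where "0 < e3" and e3: "ball a e3 \<subseteq> I"
    using \<open>open I\<close> \<open>a \<in> I\<close> open_contains_ball by blast
  define e where "e = min e1 (min e2 e3)"
  define d where "d t = (x t - y t) \<bullet> (x t - y t)" for t
  define d' where "d' t = 2 * ((x t - y t) \<bullet> (f (x t) - f (y t)))" for t
  have near: "t \<in> I" "x t \<in> cball (x a) 1" "y t \<in> cball (x a) 1" if "t \<in> ball a e" for t
  proof -
    have "dist t a < e1" "dist t a < e2" "dist a t < e3"
      using that by (auto simp: e_def dist_commute)
    then show "t \<in> I" "x t \<in> cball (x a) 1" "y t \<in> cball (x a) 1"
      using e1[of t] e2[of t] e3 eq by (auto simp: dist_commute)
  qed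
  have "d t = 0" if "t \<in> ball a e" for t
  proof (rule differential_inequality_imp_zero[where d = d and d' = d' and K = "2 * L" and I = "ball a e" and a = a])
    show "is_interval (ball a e)" "t \<in> ball a e" "a \<in> ball a e" "d a = 0"
      using that \<open>0 < e1\<close> \<open>0 < e2\<close> \<open>0 < e3\<close> eq
      by (auto simp: e_def d_def is_interval_ball_real)
    fix s assume s: "s \<in> ball a e"
    note x' = x[OF near(1)[OF s], unfolded has_vector_derivative_def]
    note y' = y[OF near(1)[OF s], unfolded has_vector_derivative_def]
    have "(d has_derivative (\<lambda>h. d' s * h)) (at s)"
      unfolding d_def
      by (rule has_derivative_eq_rhs[OF has_derivative_inner[OF has_derivative_diff[OF x' y']
              has_derivative_diff[OF x' y']]])
        (auto simp: d'_def algebra_simps inner_commute fun_eq_iff)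
    then show "(d has_real_derivative d' s) (at s)"
      by (simp add: has_field_derivative_def)
    show "0 \<le> d s"
      by (simp add: d_def)
    have "\<bar>d' s\<bar> \<le> 2 * (norm (x s - y s) * norm (f (x s) - f (y s)))"
      unfolding d'_def using Cauchy_Schwarz_ineq2[of "x s - y s" "f (x s) - f (y s)"] by simp
    also have "\<dots> \<le> 2 * (norm (x s - y s) * (L * norm (x s - y s)))"
      by (intro mult_left_mono L near[OF s]) auto
    also have "\<dots> = 2 * L * d s"
      by (simp add: d_def power2_norm_eq_inner[symmetric] power2_eq_square)
    finally show "\<bar>d' s\<bar> \<le> 2 * L * d s" .
  qed
  then have "dist t a < e \<longrightarrow> x t = y t" for t
    by (auto simp: d_def dist_commute)
  moreover have "0 < e"
    using \<open>0 < e1\<close> \<open>0 < e2\<close> \<open>0 < e3\<close> by (simp add: e_def)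
  ultimately show ?thesis
    by blast
qed

text \<open>The common domain is connected, and the set of times where the solutions agree is
  relatively closed in it by continuity and open by the local statement.\<close>

lemma solves_ivp_unique:
  fixes f :: "'a::euclidean_space \<Rightarrow> 'a"
  assumes C1: "C_times 1 f" and x: "solves_ivp f X x0 J x" and y: "solves_ivp f X x0 K y"
    and "t \<in> J" "t \<in> K"
  shows "x t = y t"
proof -
  define I where "I = J \<inter> K"
  define E where "E = {s \<in> I. x s = y s}"
  have dx: "\<And>s. s \<in> I \<Longrightarrow> (x has_vector_derivative f (x s)) (at s)"
    and dy: "\<And>s. s \<in> I \<Longrightarrow> (y has_vector_derivative f (y s)) (at s)"
    and "open I" and "0 \<in> E" and "is_interval I"
    using x y by (auto simp: solves_ivp_def I_def E_def intro: is_interval_Int)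
  then have "connected I"
    by (simp add: is_interval_connected)
  have "open E"
    unfolding open_dist
  proof
    fix a assume "a \<in> E"
    then obtain e1 where "0 < e1" "\<And>s. dist s a < e1 \<Longrightarrow> x s = y s"
      using C1_solutions_agree_locally[OF C1 \<open>open I\<close> _ _ dx dy, of a] by (auto simp: E_def)
    moreover obtain e2 where "0 < e2" "\<And>s. dist s a < e2 \<Longrightarrow> s \<in> I"
      using \<open>open I\<close> \<open>a \<in> E\<close> by (auto simp: open_dist E_def)
    ultimately show "\<exists>e>0. \<forall>s. dist s a < e \<longrightarrow> s \<in> E"
      by (intro exI[of _ "min e1 e2"]) (auto simp: E_def)
  qed
  then have "openin (top_of_set I) E"
    by (metis (no_types, lifting) E_def mem_Collect_eq open_openin_trans openin_open_eq \<open>open I\<close> subsetI)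
  moreover have "closedin (top_of_set I) E"
  proof -
    have "continuous_on I x" "continuous_on I y"
      using dx dy by (meson continuous_at_imp_continuous_on has_vector_derivative_continuous)+
    then have "continuous_on I (\<lambda>s. x s - y s)"
      by (rule continuous_on_diff)
    then have "closedin (top_of_set I) {s \<in> I. x s - y s = 0}"
      by (rule continuous_closedin_preimage_constant)
    then show ?thesis
      by (simp add: E_def)
  qed
  ultimately have "E = I"
    using \<open>connected I\<close> \<open>0 \<in> E\<close> unfolding connected_clopen by blast
  then show ?thesis
    using assms by (auto simp: E_def I_def)
qed

lemma solution_eqI:
  fixes f :: "'a::euclidean_space \<Rightarrow> 'a"
  assumes "C_times 1 f" "solves_ivp f X x0 J x" "t \<in> J"
  shows "solution f X x0 t = x t"
  unfolding solution_def using assms by (blast intro: the_equality solves_ivp_unique)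

section \<open>The correspondence between solutions\<close>

lemma open_interval_rescale:
  fixes c :: real
  assumes "open J" "is_interval J" "0 < c"
  shows "open {t. c * t \<in> J}" "is_interval {t. c * t \<in> J}"
proof -
  have "open ((\<lambda>t. c * t) -` J)"
    using \<open>open J\<close> by (intro open_vimage continuous_intros)
  then show "open {t. c * t \<in> J}"
    by (simp add: vimage_def)
  show "is_interval {t. c * t \<in> J}"
    unfolding is_interval_1
  proof (intro ballI allI impI)
    fix a b t assume "a \<in> {t. c * t \<in> J}" "b \<in> {t. c * t \<in> J}" "a \<le> t \<and> t \<le> b"
    moreover from this have "c * a \<le> c * t" "c * t \<le> c * b"
      using \<open>0 < c\<close> by auto
    ultimately show "t \<in> {t. c * t \<in> J}"
      using \<open>is_interval J\<close> unfolding is_interval_1 by blast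
  qed
qed

lemma has_vector_derivative_rescale:
  assumes "(x has_vector_derivative v) (at (c * t))"
  shows "((\<lambda>t. x (c * t)) has_vector_derivative c *\<^sub>R v) (at t)"
proof -
  have "((\<lambda>t. c * t) has_vector_derivative c) (at t)"
    by (auto intro!: derivative_eq_intros)
  from vector_diff_chain_at[OF this assms] show ?thesis
    by (simp add: o_def)
qed

lemma solves_ivp_lift:
  assumes x: "solves_ivp Z UNIV z J x" and "0 < l"
  shows "solves_ivp (lifted_field \<xi> Z) lifted_space (l *\<^sub>R z, l)
    {t. l powr \<xi> * t \<in> J} (\<lambda>t. (l *\<^sub>R x (l powr \<xi> * t), l))"
  unfolding solves_ivp_def
proof (intro conjI ballI)
  let ?c = "l powr \<xi>"
  fix t assume "t \<in> {t. ?c * t \<in> J}"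
  then have "((\<lambda>t. x (?c * t)) has_vector_derivative ?c *\<^sub>R Z (x (?c * t))) (at t)"
    using x by (intro has_vector_derivative_rescale) (auto simp: solves_ivp_def)
  then have "((\<lambda>t. (l *\<^sub>R x (?c * t), l)) has_vector_derivative
      (l *\<^sub>R ?c *\<^sub>R Z (x (?c * t)), 0)) (at t)"
    by (intro has_vector_derivative_Pair has_vector_derivative_const
        bounded_linear.has_vector_derivative[OF bounded_linear_scaleR_right])
  then show "((\<lambda>t. (l *\<^sub>R x (?c * t), l)) has_vector_derivative
      lifted_field \<xi> Z (l *\<^sub>R x (?c * t), l)) (at t)"
    using \<open>0 < l\<close> by (simp add: lifted_field_def powr_add mult.commute)
qed (use assms open_interval_rescale[of J "l powr \<xi>"]
    in \<open>auto simp: solves_ivp_def lifted_space_def\<close>)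

text \<open>The last component of the lifted field vanishes, so \<open>w\<close> keeps its initial value \<open>l\<close> and
  the factor \<open>w\<^sup>\<xi>\<^sup>+\<^sup>1\<close> in the field is the constant that the rescaling removes.\<close>

lemma lifted_snd_constant:
  assumes p: "solves_ivp (lifted_field \<xi> Z) X (z, l) J p" and "t \<in> J"
  shows "snd (p t) = l"
proof -
  have "((\<lambda>s. snd (p s)) has_vector_derivative 0) (at s within J)" if "s \<in> J" for s
  proof -
    have "(p has_vector_derivative lifted_field \<xi> Z (p s)) (at s within J)"
      using p that by (auto simp: solves_ivp_def intro: has_vector_derivative_at_within)
    from bounded_linear.has_vector_derivative[OF bounded_linear_snd this] show ?thesis
      by (simp add: lifted_field_def split_beta)
  qed
  moreover have "convex J"
    using p by (simp add: solves_ivp_def is_interval_convex)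
  ultimately obtain k where "\<And>s. s \<in> J \<Longrightarrow> snd (p s) = k"
    using has_vector_derivative_zero_constant[of J "\<lambda>s. snd (p s)"] by blast
  moreover have "0 \<in> J" "snd (p 0) = l"
    using p by (auto simp: solves_ivp_def)
  ultimately show ?thesis
    using \<open>t \<in> J\<close> by metis
qed

lemma solves_ivp_unlift:
  assumes p: "solves_ivp (lifted_field \<xi> Z) lifted_space (l *\<^sub>R z, l) J p" and "0 < l"
  shows "solves_ivp Z UNIV z {s. l powr (-\<xi>) * s \<in> J}
    (\<lambda>s. inverse l *\<^sub>R fst (p (l powr (-\<xi>) * s)))"
  unfolding solves_ivp_def
proof (intro conjI ballI)
  let ?c = "l powr (-\<xi>)"
  fix s assume "s \<in> {s. ?c * s \<in> J}"
  then have s: "?c * s \<in> J"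
    by simp
  have "(p has_vector_derivative lifted_field \<xi> Z (p (?c * s))) (at (?c * s))"
    using p s by (auto simp: solves_ivp_def)
  from bounded_linear.has_vector_derivative[OF bounded_linear_fst this]
  have "((\<lambda>s. fst (p s)) has_vector_derivative
      l powr (\<xi> + 1) *\<^sub>R Z (inverse l *\<^sub>R fst (p (?c * s)))) (at (?c * s))"
    using lifted_snd_constant[OF p s] by (simp add: lifted_field_def split_beta)
  from bounded_linear.has_vector_derivative[OF bounded_linear_scaleR_right
      has_vector_derivative_rescale[OF this], of "inverse l"]
  have "((\<lambda>s. inverse l *\<^sub>R fst (p (?c * s))) has_vector_derivative
      (inverse l * (?c * l powr (\<xi> + 1))) *\<^sub>R Z (inverse l *\<^sub>R fst (p (?c * s)))) (at s)"
    by simp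
  moreover have "inverse l * (?c * l powr (\<xi> + 1)) = 1"
    using \<open>0 < l\<close> by (simp flip: powr_add)
  ultimately show "((\<lambda>s. inverse l *\<^sub>R fst (p (?c * s))) has_vector_derivative
      Z (inverse l *\<^sub>R fst (p (?c * s)))) (at s)"
    by simp
qed (use assms open_interval_rescale[of J "l powr (-\<xi>)"] in \<open>auto simp: solves_ivp_def\<close>)

section \<open>Trigger times\<close>

lemma existence_interval_lifted_iff:
  assumes "0 < l"
  shows "t \<in> existence_interval (lifted_field \<xi> Z) lifted_space (l *\<^sub>R z, l) \<longleftrightarrow>
    l powr \<xi> * t \<in> existence_interval Z UNIV z"
proof
  assume "t \<in> existence_interval (lifted_field \<xi> Z) lifted_space (l *\<^sub>R z, l)"
  then obtain J p where "solves_ivp (lifted_field \<xi> Z) lifted_space (l *\<^sub>R z, l) J p" "t \<in> J"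
    by (auto simp: existence_interval_def)
  moreover have "l powr (-\<xi>) * (l powr \<xi> * t) = t"
    using assms by (simp flip: powr_add mult.assoc)
  then have "l powr \<xi> * t \<in> {s. l powr (-\<xi>) * s \<in> J}"
    unfolding mem_Collect_eq using \<open>t \<in> J\<close> by metis
  ultimately show "l powr \<xi> * t \<in> existence_interval Z UNIV z"
    using solves_ivp_unlift[of \<xi> Z l z J p] assms unfolding existence_interval_def by blast
next
  assume "l powr \<xi> * t \<in> existence_interval Z UNIV z"
  then obtain J x where "solves_ivp Z UNIV z J x" "l powr \<xi> * t \<in> J"
    by (auto simp: existence_interval_def)
  then show "t \<in> existence_interval (lifted_field \<xi> Z) lifted_space (l *\<^sub>R z, l)"
    using solves_ivp_lift[of Z z J x l \<xi>] assms unfolding existence_interval_def by blast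
qed

text \<open>Uniqueness for the lifted system is obtained here by pulling an arbitrary competitor
  \<open>p\<close> back to the original system.\<close>

lemma solution_lifted:
  fixes Z :: "'a::euclidean_space \<Rightarrow> 'a"
  assumes C1: "C_times 1 Z" and "0 < l" and t: "l powr \<xi> * t \<in> existence_interval Z UNIV z"
  shows "solution (lifted_field \<xi> Z) lifted_space (l *\<^sub>R z, l) t =
    (l *\<^sub>R solution Z UNIV z (l powr \<xi> * t), l)"
  unfolding solution_def[of "lifted_field \<xi> Z"]
proof (rule the_equality)
  obtain J x where x: "solves_ivp Z UNIV z J x" "l powr \<xi> * t \<in> J"
    using t by (auto simp: existence_interval_def)
  show "\<exists>J p. solves_ivp (lifted_field \<xi> Z) lifted_space (l *\<^sub>R z, l) J p \<and> t \<in> J \<and>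
      (l *\<^sub>R solution Z UNIV z (l powr \<xi> * t), l) = p t"
    using solves_ivp_lift[OF x(1) \<open>0 < l\<close>, of \<xi>] x(2) solution_eqI[OF C1 x] by fastforce
next
  fix q
  assume "\<exists>J p. solves_ivp (lifted_field \<xi> Z) lifted_space (l *\<^sub>R z, l) J p \<and> t \<in> J \<and> q = p t"
  then obtain J p where p: "solves_ivp (lifted_field \<xi> Z) lifted_space (l *\<^sub>R z, l) J p"
    and "t \<in> J" and q: "q = p t"
    by blast
  have inv: "l powr (-\<xi>) * (l powr \<xi> * t) = t"
    using \<open>0 < l\<close> by (simp flip: powr_add mult.assoc)
  have "solution Z UNIV z (l powr \<xi> * t) = inverse l *\<^sub>R fst q"
    using solution_eqI[OF C1 solves_ivp_unlift[OF p \<open>0 < l\<close>], of "l powr \<xi> * t"] \<open>t \<in> J\<close>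
    by (simp add: inv q)
  moreover have "snd q = l"
    using lifted_snd_constant[OF p \<open>t \<in> J\<close>] q by simp
  ultimately show "q = (l *\<^sub>R solution Z UNIV z (l powr \<xi> * t), l)"
    using \<open>0 < l\<close> by (simp add: prod_eq_iff)
qed

lemma trigger_times_lifted:
  fixes Z :: "'a::euclidean_space \<Rightarrow> 'a"
  assumes "C_times 1 Z" "0 < l"
  shows "trigger_times (lifted_field \<xi> Z) lifted_space (\<lambda>p. g (inverse l *\<^sub>R fst p)) (l *\<^sub>R z, l) =
    {t. l powr \<xi> * t \<in> trigger_times Z UNIV g z}"
  using assms
  by (auto simp: trigger_times_def existence_interval_lifted_iff solution_lifted zero_less_mult_iff)

lemma is_min_or_infinity_rescale:
  assumes S: "is_min_or_infinity A S" and T: "is_min_or_infinity {t. c * t \<in> A} T" and "0 < c"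
  shows "S = ereal c * T"
proof (cases "A = {}")
  case True
  then show ?thesis
    using S T \<open>0 < c\<close> by (simp add: is_min_or_infinity_def)
next
  case False
  then obtain s where s: "s \<in> A" "\<And>r. r \<in> A \<Longrightarrow> s \<le> r" "S = ereal s"
    using S by (auto simp: is_min_or_infinity_def)
  then have "c * (s / c) \<in> A"
    using \<open>0 < c\<close> by simp
  then obtain t where t: "c * t \<in> A" "t \<le> s / c" "T = ereal t"
    using T unfolding is_min_or_infinity_def by blast
  have "s = c * t"
    using s(2)[OF t(1)] t(2) \<open>0 < c\<close> by (simp add: field_simps)
  then show ?thesis
    using s(3) t(3) by simp
qed

theorem mainTheorem2:
  fixes n :: nat
    and Z :: "real ^ 'm \<Rightarrow> real ^ 'm"
    and \<Gamma> :: "real ^ 'm \<Rightarrow> real"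
    and \<xi> :: real
    and \<tau> :: "real ^ 'm \<Rightarrow> ereal"
    and \<tau>' :: "(real ^ 'm) \<times> real \<Rightarrow> ereal"
  assumes "CARD('m) = 2 * n"
    and "smooth Z"
    and "smooth \<Gamma>"
    and "\<And>z. is_inter_execution_time Z UNIV \<Gamma> z (\<tau> z)"
    and "\<And>z w. w > 0 \<Longrightarrow>
           is_inter_execution_time (lifted_field \<xi> Z) lifted_space
             (\<lambda>p. \<Gamma> (inverse w *\<^sub>R fst p)) (z, w) (\<tau>' (z, w))"
  shows "\<forall>z. \<forall>l::real. l > 0 \<longrightarrow> \<tau> z = ereal (l powr \<xi>) * \<tau>' (l *\<^sub>R z, l)"
proof (intro allI impI)
  fix z :: "real ^ 'm" and l :: real
  assume "0 < l"
  have "C_times 1 Z"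
    using \<open>smooth Z\<close> unfolding smooth_def by blast
  then have "is_min_or_infinity {t. l powr \<xi> * t \<in> trigger_times Z UNIV \<Gamma> z} (\<tau>' (l *\<^sub>R z, l))"
    using assms(5)[OF \<open>0 < l\<close>, of "l *\<^sub>R z"] \<open>0 < l\<close>
    by (simp only: is_inter_execution_time_def trigger_times_lifted)
  then show "\<tau> z = ereal (l powr \<xi>) * \<tau>' (l *\<^sub>R z, l)"
    using assms(4)[of z] \<open>0 < l\<close>
    by (intro is_min_or_infinity_rescale) (auto simp: is_inter_execution_time_def)
qed

end
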